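(* For any two elements $x,y\in\mathcal R$, we have $x\oplus y=y\oplus x$.
   Context: $\mathbb N=\{1,2,3,\dots\}$ and $\mathcal Z_{10}=\{0,1,\dots,9\}$. $\mathcal R$ is the set of all formal decimals $x=x_0.x_1x_2x_3\cdots$ with $x_0\in\mathbb Z$ and $x_k\in\mathcal Z_{10}$ for $k\in\mathbb N$; two elements are equal iff all their digits agree. For $k\in\mathbb N$, $[x]_k=\sum_{i=0}^k x_i10^{-i}\in\mathbb Q$. Order on $\mathcal R$: $x\preceq y$ iff $[x]_k\le [y]_k$ for all $k\in\mathbb N$. Every nonempty bounded above (below) subset of $(\mathcal R,\preceq)$ has a supremum (infimum). $\mathbb Q$ is regarded as a subset of $\mathcal R$ via long division: $\alpha=q/p$ ($p\in\mathbb N$, $q\in\mathbb Z$) is identified with $\alpha_0.\alpha_1\alpha_2\cdots$, where $\alpha_0=\lfloor q/p\rfloor$, $\beta_0=q-\alpha_0p$, $\alpha_{k+1}=\lfloor 10\beta_k/p\rfloor$, $\beta_{k+1}=10\beta_k-\alpha_{k+1}p$. For a bounded sequence $\{x^{(n)}\}_{n\in\mathbb N}$ in $\mathcal R$: $\overline{\mathrm{LIMIT}}(\{x^{(n)}\})=\inf\{\sup\{x^{(k)}: k\ge n\}: n\in\mathbb N\}$ and $\underline{\mathrm{LIMIT}}(\{x^{(n)}\})=\sup\{\inf\{x^{(k)}: k\ge n\}: n\in\mathbb N\}$; if they are equal, the common value is denoted $\mathrm{LIMIT}(\{x^{(n)}\})$. It exists for bounded monotone sequences. Addition: $x\oplus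 y=\mathrm{LIMIT}(\{[x]_k+[y]_k\}_{k\in\mathbb N})$, the sums $[x]_k+[y]_k$ being taken in $\mathbb Q$. *)

theory Defs
  imports Complex_Main
begin

text \<open>Position 0 holds the (possibly negative) integer part; the remaining positions hold the
  decimal digits. No two expansions are identified, so \<open>0.999\<dots>\<close> and \<open>1.000\<dots>\<close> are distinct.\<close>

typedef decimal = "{x :: nat \<Rightarrow> int. \<forall>k\<ge>1. x k \<in> {0..9}}"
  morphisms digit Abs_decimal
  by (rule exI[of _ "\<lambda>_. 0"]) simp

definition trunc :: "nat \<Rightarrow> decimal \<Rightarrow> rat" where
  "trunc k x = (\<Sum>i=0..k. of_int (digit x i) / 10 ^ i)"

text \<open>\<open>scaled x k\<close> is the integer \<open>10\<^sup>k [x]\<^sub>k\<close>; it is used only in proofs.\<close>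

primrec scaled :: "decimal \<Rightarrow> nat \<Rightarrow> int" where
  "scaled x 0 = digit x 0"
| "scaled x (Suc k) = 10 * scaled x k + digit x (Suc k)"

lemma digit_bounds: "0 \<le> digit x (Suc k)" "digit x (Suc k) \<le> 9"
  using digit[of x] by auto

lemma trunc_scaled: "trunc k x = of_int (scaled x k) / 10 ^ k"
  unfolding trunc_def by (induction k) (simp_all add: field_simps)

lemma trunc_le_iff: "trunc k x \<le> trunc k y \<longleftrightarrow> scaled x k \<le> scaled y k"
  by (simp add: trunc_scaled divide_le_cancel)

lemma scaled_div: "scaled x (Suc k) div 10 = scaled x k"
  using digit_bounds[of x k] by simp

lemma scaled_le_down: "scaled x (Suc k) \<le> scaled y (Suc k) \<Longrightarrow> scaled x k \<le> scaled y k"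
  by (metis scaled_div zdiv_mono1 zero_less_numeral)

lemma scaled_less_up:
  assumes "k \<le> j" "scaled x k < scaled y k" shows "scaled x j < scaled y j"
  using assms by (induction j rule: dec_induct) (use scaled_le_down not_le in blast)+

lemma decimal_eqI:
  assumes "\<And>k. scaled x k = scaled y k" shows "x = y"
proof -
  have "digit x k = digit y k" for k
    using assms[of k] assms[of "k - 1"] by (cases k) auto
  then show ?thesis by (metis digit_inverse ext)
qed

lemma scaled_realize:
  assumes "\<And>k. M (Suc k) div 10 = (M k :: int)"
  obtains s where "\<And>k. scaled s k = M k"
proof -
  define f where "f k = (case k of 0 \<Rightarrow> M 0 | Suc j \<Rightarrow> M (Suc j) - 10 * M j)" for k
  have "M (Suc j) - 10 * M j = M (Suc j) mod 10" for j
    using assms[of j] by (simp add: minus_mult_div_eq_mod [symmetric])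
  moreover have "0 \<le> m mod 10" "m mod 10 \<le> 9" for m :: int
    by presburger+
  ultimately have "f \<in> {x. \<forall>k\<ge>1. x k \<in> {0..9}}"
    by (auto simp: f_def split: nat.split)
  then have d: "digit (Abs_decimal f) = f" by (rule Abs_decimal_inverse)
  have "scaled (Abs_decimal f) k = M k" for k
    by (induction k) (simp_all add: d, simp_all add: f_def)
  then show ?thesis using that by blast
qed

instantiation decimal :: linorder
begin

definition less_eq_decimal :: "decimal \<Rightarrow> decimal \<Rightarrow> bool" where
  "x \<le> y \<longleftrightarrow> (\<forall>k\<ge>1. trunc k x \<le> trunc k y)"

definition less_decimal :: "decimal \<Rightarrow> decimal \<Rightarrow> bool" where
  "x < y \<longleftrightarrow> x \<le> y \<and> \<not> y \<le> (x :: decimal)"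

lemma le_decimal_iff: "x \<le> y \<longleftrightarrow> (\<forall>k. scaled x k \<le> scaled y k)"
proof
  assume "x \<le> y"
  then have "scaled x (Suc k) \<le> scaled y (Suc k)" for k
    unfolding less_eq_decimal_def trunc_le_iff by (simp del: scaled.simps)
  then show "\<forall>k. scaled x k \<le> scaled y k" using scaled_le_down by blast
qed (simp add: less_eq_decimal_def trunc_le_iff)

instance
proof
  fix x y z :: decimal
  show "x < y \<longleftrightarrow> x \<le> y \<and> \<not> y \<le> x" by (rule less_decimal_def)
  show "x \<le> x" by (simp add: le_decimal_iff)
  show "x \<le> y \<Longrightarrow> y \<le> z \<Longrightarrow> x \<le> z" by (meson le_decimal_iff order_trans)
  show "x \<le> y \<Longrightarrow> y \<le> x \<Longrightarrow> x = y" by (meson decimal_eqI le_decimal_iff order_antisym)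
  show "x \<le> y \<or> y \<le> x"
    unfolding le_decimal_iff by (meson nle_le not_le scaled_less_up)
qed

end

lemma decimal_lub:
  fixes S :: "decimal set"
  assumes "S \<noteq> {}" "\<And>x. x \<in> S \<Longrightarrow> x \<le> b"
  obtains s where "\<And>x. x \<in> S \<Longrightarrow> x \<le> s" "\<And>z. (\<And>x. x \<in> S \<Longrightarrow> x \<le> z) \<Longrightarrow> s \<le> z"
proof -
  have "\<exists>m\<in>(\<lambda>x. scaled x k) ` S. \<forall>x\<in>S. scaled x k \<le> m" for k
  proof -
    obtain a where a: "a \<in> S" using assms(1) by blast
    let ?A = "(\<lambda>x. scaled x k) ` S \<inter> {scaled a k..scaled b k}"
    have fin: "finite ?A" "?A \<noteq> {}" using a assms(2) by (auto simp: le_decimal_iff)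
    have "scaled x k \<le> Max ?A" if "x \<in> S" for x
    proof (cases "scaled a k \<le> scaled x k")
      case True
      then show ?thesis using that assms(2) fin by (intro Max_ge) (auto simp: le_decimal_iff)
    next
      case False
      moreover have "scaled a k \<le> Max ?A"
        using a assms(2) fin by (intro Max_ge) (auto simp: le_decimal_iff)
      ultimately show ?thesis by linarith
    qed
    then show ?thesis using Max_in[OF fin] by blast
  qed
  then obtain M where M: "\<And>k. M k \<in> (\<lambda>x. scaled x k) ` S" "\<And>k x. x \<in> S \<Longrightarrow> scaled x k \<le> M k"
    by metis
  have "M (Suc k) div 10 = M k" for k
  proof (rule antisym)
    obtain x where "x \<in> S" "M (Suc k) = scaled x (Suc k)" using M(1) by blast
    then show "M (Suc k) div 10 \<le> M k" using M(2) scaled_div by metis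
    obtain y where "y \<in> S" "M k = scaled y k" using M(1) by blast
    then show "M k \<le> M (Suc k) div 10" using M(2) scaled_div zdiv_mono1 zero_less_numeral by metis
  qed
  then obtain s where s: "\<And>k. scaled s k = M k" using scaled_realize by blast
  show ?thesis
  proof
    show "\<And>x. x \<in> S \<Longrightarrow> x \<le> s" by (simp add: le_decimal_iff s M(2))
    show "s \<le> z" if "\<And>x. x \<in> S \<Longrightarrow> x \<le> z" for z
      unfolding le_decimal_iff s using M(1) that by (metis imageE le_decimal_iff)
  qed
qed

instantiation decimal :: conditionally_complete_linorder
begin

definition "inf x y = min x (y :: decimal)"
definition "sup x y = max x (y :: decimal)"

definition "Sup (S :: decimal set) = (LEAST s. \<forall>x\<in>S. x \<le> s)"

definition "Inf (S :: decimal set) = (GREATEST s. \<forall>x\<in>S. s \<le> x)"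

lemma Sup_decimal_lub:
  fixes S :: "decimal set"
  assumes "S \<noteq> {}" "bdd_above S"
  shows "(\<forall>x\<in>S. x \<le> Sup S) \<and> (\<forall>z. (\<forall>x\<in>S. x \<le> z) \<longrightarrow> Sup S \<le> z)"
proof -
  obtain b where "\<And>x. x \<in> S \<Longrightarrow> x \<le> b" using assms(2) by (auto simp: bdd_above_def)
  with assms(1) obtain s where
    s: "\<And>x. x \<in> S \<Longrightarrow> x \<le> s" "\<And>z. (\<And>x. x \<in> S \<Longrightarrow> x \<le> z) \<Longrightarrow> s \<le> z"
    using decimal_lub by metis
  then have "Sup S = s" unfolding Sup_decimal_def by (intro Least_equality) auto
  with s show ?thesis by auto
qed

lemma Inf_decimal_glb:
  fixes S :: "decimal set"
  assumes "S \<noteq> {}" "bdd_below S"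
  shows "(\<forall>x\<in>S. Inf S \<le> x) \<and> (\<forall>z. (\<forall>x\<in>S. z \<le> x) \<longrightarrow> z \<le> Inf S)"
proof -
  let ?L = "{l. \<forall>x\<in>S. l \<le> x}"
  have "?L \<noteq> {}" using assms(2) by (auto simp: bdd_below_def)
  moreover obtain a where "a \<in> S" using assms(1) by blast
  ultimately obtain s where
    s: "\<And>x. x \<in> ?L \<Longrightarrow> x \<le> s" "\<And>z. (\<And>x. x \<in> ?L \<Longrightarrow> x \<le> z) \<Longrightarrow> s \<le> z"
    using decimal_lub[of ?L a] by blast
  then have "Inf S = s" unfolding Inf_decimal_def by (intro Greatest_equality) auto
  with s show ?thesis by auto
qed

instance
proof
  fix x y z :: decimal and S :: "decimal set"
  show "inf x y \<le> x" "inf x y \<le> y" "x \<le> y \<Longrightarrow> x \<le> z \<Longrightarrow> x \<le> inf y z"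
    by (auto simp: inf_decimal_def)
  show "x \<le> sup x y" "y \<le> sup x y" "y \<le> x \<Longrightarrow> z \<le> x \<Longrightarrow> sup y z \<le> x"
    by (auto simp: sup_decimal_def)
  show "x \<in> S \<Longrightarrow> bdd_below S \<Longrightarrow> Inf S \<le> x" using Inf_decimal_glb by blast
  show "S \<noteq> {} \<Longrightarrow> (\<And>x. x \<in> S \<Longrightarrow> z \<le> x) \<Longrightarrow> z \<le> Inf S"
    using Inf_decimal_glb by (metis bdd_belowI)
  show "x \<in> S \<Longrightarrow> bdd_above S \<Longrightarrow> x \<le> Sup S" using Sup_decimal_lub by blast
  show "S \<noteq> {} \<Longrightarrow> (\<And>x. x \<in> S \<Longrightarrow> x \<le> z) \<Longrightarrow> Sup S \<le> z"
    using Sup_decimal_lub by (metis bdd_aboveI)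
qed

end

text \<open>Long division of \<open>q\<close> by \<open>p > 0\<close>: step \<open>k\<close> yields the pair \<open>(\<alpha>\<^sub>k, \<beta>\<^sub>k)\<close> of digit and
  remainder. On integers \<open>a div p\<close> is \<open>\<lfloor>a / p\<rfloor>\<close>.\<close>

primrec long_div :: "int \<Rightarrow> int \<Rightarrow> nat \<Rightarrow> int \<times> int" where
  "long_div q p 0 = (let a = q div p in (a, q - a * p))"
| "long_div q p (Suc k) =
    (let b = snd (long_div q p k); a = (10 * b) div p in (a, 10 * b - a * p))"

text \<open>\<open>quotient_of\<close> returns the reduced fraction with positive denominator; by
  \<open>dec_of_rat_Fract\<close> below every other representation gives the same decimal.\<close>

definition dec_of_rat :: "rat \<Rightarrow> decimal" where
  "dec_of_rat r = (case quotient_of r of (q, p) \<Rightarrow> Abs_decimal (\<lambda>k. fst (long_div q p k)))"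

lemma long_div_rem:
  assumes "p > 0" shows "0 \<le> snd (long_div q p k)" "snd (long_div q p k) < p"
  using assms by (induction k) (simp_all add: Let_def minus_div_mult_eq_mod)

lemma digit_long_div:
  assumes "p > 0"
  shows "digit (Abs_decimal (\<lambda>k. fst (long_div q p k))) = (\<lambda>k. fst (long_div q p k))"
proof (rule Abs_decimal_inverse)
  have "fst (long_div q p (Suc k)) \<in> {0..9}" for k
  proof -
    let ?b = "10 * snd (long_div q p k)"
    have "?b < 10 * p" using long_div_rem(2)[OF assms] by simp
    moreover have "?b div p * p \<le> ?b"
      using pos_mod_sign[OF assms, of ?b] div_mult_mod_eq[of ?b p] by linarith
    ultimately have "?b div p * p < 10 * p" by linarith
    then have "?b div p < 10" by (rule mult_less_cancel_right_pos[OF assms, THEN iffD1])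
    moreover have "0 \<le> ?b div p"
      using assms long_div_rem(1)[OF assms] by (simp add: pos_imp_zdiv_nonneg_iff)
    ultimately show ?thesis by (simp add: Let_def)
  qed
  then show "(\<lambda>k. fst (long_div q p k)) \<in> {x. \<forall>k\<ge>1. x k \<in> {0..9}}"
    by (auto simp: Suc_le_eq gr0_conv_Suc simp del: long_div.simps)
qed

lemma scaled_long_div:
  assumes "p > 0"
  shows "scaled (Abs_decimal (\<lambda>k. fst (long_div q p k))) k = \<lfloor>of_int q / of_int p * 10 ^ k :: rat\<rfloor>"
    (is "scaled ?x k = _")
proof -
  have "scaled ?x k * p + snd (long_div q p k) = q * 10 ^ k"
    by (induction k) (simp_all add: digit_long_div[OF assms] Let_def algebra_simps)
  moreover have "0 \<le> snd (long_div q p k)" "snd (long_div q p k) < p"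
    using long_div_rem[OF assms] by auto
  ultimately have "scaled ?x k = (q * 10 ^ k) div p"
    using assms by (intro int_div_pos_eq[symmetric]) (auto simp: mult.commute)
  also have "\<dots> = \<lfloor>of_int (q * 10 ^ k) / of_int p :: rat\<rfloor>"
    by (rule floor_divide_of_int_eq[symmetric])
  finally show ?thesis by simp
qed

lemma scaled_dec_of_rat: "scaled (dec_of_rat r) k = \<lfloor>r * 10 ^ k\<rfloor>"
proof -
  obtain q p where qp: "quotient_of r = (q, p)" by fastforce
  then have p: "p > 0" and r: "r = of_int q / of_int p"
    by (rule quotient_of_denom_pos, rule quotient_of_div)
  have "dec_of_rat r = Abs_decimal (\<lambda>k. fst (long_div q p k))"
    unfolding dec_of_rat_def qp by simp
  then show ?thesis using scaled_long_div[OF p, of q k] unfolding r by (rule ssubst)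
qed

lemma dec_of_rat_Fract:
  assumes "p > 0"
  shows "dec_of_rat (of_int q / of_int p) = Abs_decimal (\<lambda>k. fst (long_div q p k))"
  by (rule decimal_eqI) (simp add: scaled_dec_of_rat scaled_long_div[OF assms])

lemma dec_of_rat_mono: "r \<le> s \<Longrightarrow> dec_of_rat r \<le> dec_of_rat s"
  by (auto simp: le_decimal_iff scaled_dec_of_rat intro!: floor_mono mult_right_mono)

text \<open>A sequence indexed by \<open>{1, 2, \<dots>}\<close> is a function on \<^typ>\<open>nat\<close> whose value at 0 is
  irrelevant.\<close>

definition seq_bounded :: "(nat \<Rightarrow> decimal) \<Rightarrow> bool" where
  "seq_bounded X \<longleftrightarrow> bdd_above (X ` {1..}) \<and> bdd_below (X ` {1..})"

definition upper_LIMIT :: "(nat \<Rightarrow> decimal) \<Rightarrow> decimal" where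
  "upper_LIMIT X = (INF n\<in>{1..}. SUP k\<in>{n..}. X k)"

definition lower_LIMIT :: "(nat \<Rightarrow> decimal) \<Rightarrow> decimal" where
  "lower_LIMIT X = (SUP n\<in>{1..}. INF k\<in>{n..}. X k)"

definition has_LIMIT :: "(nat \<Rightarrow> decimal) \<Rightarrow> decimal \<Rightarrow> bool" where
  "has_LIMIT X l \<longleftrightarrow> seq_bounded X \<and> upper_LIMIT X = l \<and> lower_LIMIT X = l"

definition LIMIT :: "(nat \<Rightarrow> decimal) \<Rightarrow> decimal" where
  "LIMIT X = (THE l. has_LIMIT X l)"

lemma LIMIT_eq: "has_LIMIT X l \<Longrightarrow> LIMIT X = l"
  unfolding LIMIT_def by (auto simp: has_LIMIT_def)

definition dec_add :: "decimal \<Rightarrow> decimal \<Rightarrow> decimal" (infixl \<open>\<oplus>\<close> 65) where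
  "x \<oplus> y = LIMIT (\<lambda>k. dec_of_rat (trunc k x + trunc k y))"

lemma has_LIMIT_mono:
  assumes mono: "\<And>m n. 1 \<le> m \<Longrightarrow> m \<le> n \<Longrightarrow> X m \<le> X n" and bdd: "bdd_above (X ` {1..})"
  shows "has_LIMIT X (SUP k\<in>{1..}. X k)"
proof -
  have below: "bdd_below (X ` {1..})"
    using mono by (intro bdd_belowI[of _ "X 1"]) auto
  have tail: "(SUP k\<in>{n..}. X k) = (SUP k\<in>{1..}. X k)" if "1 \<le> n" for n
  proof (rule antisym)
    have bdd': "bdd_above (X ` {n..})"
      using bdd by (rule bdd_above_mono) (use that in auto)
    show "(SUP k\<in>{n..}. X k) \<le> (SUP k\<in>{1..}. X k)"
      using bdd that by (intro cSUP_subset_mono) auto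
    show "(SUP k\<in>{1..}. X k) \<le> (SUP k\<in>{n..}. X k)"
    proof (rule cSUP_mono)
      show "\<exists>m\<in>{n..}. X k \<le> X m" if "k \<in> {1..}" for k
        using that mono[of k "max k n"] by auto
    qed (use bdd' in auto)
  qed
  have "(INF k\<in>{n..}. X k) = X n" if "1 \<le> n" for n
    using that mono by (intro cInf_eq_minimum) auto
  then have "lower_LIMIT X = (SUP k\<in>{1..}. X k)"
    unfolding lower_LIMIT_def by (intro SUP_cong) auto
  moreover have "upper_LIMIT X = (INF n\<in>{1::nat..}. SUP k\<in>{1..}. X k)"
    unfolding upper_LIMIT_def by (intro INF_cong refl tail) simp
  then have "upper_LIMIT X = (SUP k\<in>{1..}. X k)" by simp
  ultimately show ?thesis using bdd below by (simp add: has_LIMIT_def seq_bounded_def)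
qed

text \<open>The limit defining \<open>x \<oplus> y\<close> always exists, so \<open>\<oplus>\<close> never takes the unspecified value of
  \<open>THE\<close>.\<close>

lemma dec_add_has_LIMIT: "has_LIMIT (\<lambda>k. dec_of_rat (trunc k x + trunc k y)) (x \<oplus> y)"
proof -
  let ?X = "\<lambda>k. dec_of_rat (trunc k x + trunc k y)"
  have trunc_mono: "trunc m z \<le> trunc n z" if "m \<le> n" for m n z
    using that
  proof (induction n rule: dec_induct)
    case (step n)
    have "trunc (Suc n) z = trunc n z + of_int (digit z (Suc n)) / 10 ^ Suc n"
      by (simp add: trunc_def)
    then have "trunc n z \<le> trunc (Suc n) z" using digit_bounds(1)[of z n] by simp
    with step show ?case by linarith
  qed simp
  have trunc_bound: "trunc k z \<le> of_int (digit z 0) + 1 - 1 / 10 ^ k" for k z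
  proof (induction k)
    case (Suc n)
    have "of_int (digit z (Suc n)) \<le> (9 :: rat)" using digit_bounds(2)[of z n] by linarith
    then have "of_int (digit z (Suc n)) / 10 ^ Suc n \<le> (9 :: rat) / 10 ^ Suc n"
      by (intro divide_right_mono) auto
    moreover have "trunc (Suc n) z = trunc n z + of_int (digit z (Suc n)) / 10 ^ Suc n"
      by (simp add: trunc_def)
    moreover have "(9 :: rat) / 10 ^ Suc n = 1 / 10 ^ n - 1 / 10 ^ Suc n" by simp
    ultimately show ?case using Suc by linarith
  qed (simp add: trunc_def)
  have trunc_bound': "trunc k z \<le> of_int (digit z 0) + 1" for k z
  proof -
    have "(0 :: rat) \<le> 1 / 10 ^ k" by simp
    then show ?thesis using trunc_bound[of k z] by linarith
  qed
  have "has_LIMIT ?X (SUP k\<in>{1..}. ?X k)"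
  proof (rule has_LIMIT_mono)
    show "?X m \<le> ?X n" if "m \<le> n" for m n
      using that by (intro dec_of_rat_mono add_mono trunc_mono)
    show "bdd_above (?X ` {1..})"
      by (rule bdd_aboveI2[where M = "dec_of_rat (of_int (digit x 0) + 1 + (of_int (digit y 0) + 1))"])
        (intro dec_of_rat_mono add_mono trunc_bound')
  qed
  then show ?thesis by (simp add: dec_add_def LIMIT_eq)
qed

end

theory Submission
  imports Defs
begin

text \<open>Commutativity is inherited from the rationals: the sequences defining the two sums have
  \<open>k\<close>-th terms \<open>dec_of_rat (trunc k x + trunc k y)\<close> and
  \<open>dec_of_rat (trunc k y + trunc k x)\<close>. The truncations are added as rationals before
  conversion to decimals, so the sequences agree term by term, and \<open>LIMIT\<close> assigns them
  the same value.\<close>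

theorem theorem3p4:
  fixes x y :: decimal
  shows "x \<oplus> y = y \<oplus> x"
  unfolding dec_add_def by (simp add: add.commute)

end
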